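(* Let $H_1,\dots,H_r$ be groups with a normalized $r$-total system $S^{(r)}$, and suppose that $G=H_1\times\cdots\times H_r$ with the associated multiplication $\mu$ (written $x\cdot y$) is a group. Let $G'$ be a group, let $f_i:H_i\to G'$ ($1\le i\le r$) be group homomorphisms, and define $f:G\to G'$ by $f(h_1,\dots,h_r)=f_1(h_1)\cdots f_r(h_r)$. Then $f$ is a homomorphism if and only if $$f\big([a_k,b_j]\big)=\big[f(a_k),f(b_j)\big]$$ for all $k>j$, $a_k\in H_k$, $b_j\in H_j$. Moreover, if for a particular pair of indices $k>j$ the subgroup $H_j$ of $G$ is closed under conjugation by $H_k$, then for that pair this condition simplifies to (is equivalent to) the condition $$f\big({}^{a_k}b_j\big)={}^{f(a_k)}f(b_j)\quad\text{for all }a_k\in H_k,\ b_j\in H_j.$$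
   Context: Let $r\ge1$ and let $H_1,\dots,H_r$ be groups. An $r$-total system $S^{(r)}$ consists of maps $\phi_k^j:H_k\to \mathrm{Maps}(H_j,H_j)$ for all $r\ge k>j\ge1$ (where $\mathrm{Maps}(H_j,H_j)$ is the set of all set-theoretic self-maps of $H_j$; the value of $\phi_k^j(h_k)$ at $h_j$ is written ${}^{\phi_k^j(h_k)}h_j$) and maps (brackets) $[\cdot,\cdot]_{kj}^i:H_k\times H_j\to H_i$ for all $r\ge k>j>i\ge1$. It is normalized if: $\phi_j^i(1)=\mathrm{id}_{H_i}$ and ${}^{\phi_j^i(h_j)}1=1$ for all $r\ge j>i\ge1$, $h_j\in H_j$; and $[1,h_j]_{kj}^i=1$, $[h_k,1]_{kj}^i=1$ for all $r\ge k>j>i\ge1$, $h_j\in H_j$, $h_k\in H_k$. Let $G$ be the set $H_1\times\cdots\times H_r$. For $0\le k\le r$ let $R_k\subseteq G$ be the set of tuples $(h_1,\dots,h_k,1,\dots,1)$. An element $h_i\in H_i$ is identified with the tuple in $G$ having $h_i$ in position $i$ and $1$ elsewhere. For $k>j$, $h_k\in H_k$, $h_j\in H_j$ put $$\phi_{h_k}(h_j)=\big([h_k,h_j]_{kj}^1,\dots,[h_k,h_j]_{kj}^{j-1},{}^{\phi_k^j(h_k)}h_j,1,\dots,1\big)\in R_j.$$ Multiplications $\mu_k:R_k\times R_k\to R_k$ are defined recursively. $\mu_1$ is the group law of $H_1$. Given $\mu_k$, write $\mu_k(w_1)=w_1$ and $\mu_k(w_1,\dots,w_m)=\mu_k(\mu_k(w_1,\dots,w_{m-1}),w_m)$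 for $w_1,\dots,w_m\in R_k$; then for $a=(a_1,\dots,a_{k+1},1,\dots,1)$ and $b=(b_1,\dots,b_{k+1},1,\dots,1)$, $\mu_{k+1}(a,b)$ is the tuple whose first $k$ entries are those of $$\mu_k\big((a_1,\dots,a_k,1,\dots,1),\ \mu_k(\phi_{a_{k+1}}(b_1),\dots,\phi_{a_{k+1}}(b_k))\big),$$ whose $(k+1)$st entry is $a_{k+1}b_{k+1}$, and whose other entries are $1$. Put $\mu=\mu_r:G\times G\to G$, $x\cdot y=\mu(x,y)$. For $k>j$, the commutator bracket in $G$ is $[a_k,b_j]:=\phi_{a_k}(b_j)\cdot b_j^{-1}\in R_j$, which, $G$ being a group, is the usual commutator $a_k b_j a_k^{-1}b_j^{-1}$ in $G$. In any group, $[x,y]=xyx^{-1}y^{-1}$ and ${}^{x}y=xyx^{-1}$; in the last condition ${}^{a_k}b_j$ is the conjugate in $G$, which under the stated closure hypothesis lies in $H_j$ and equals ${}^{\phi_k^j(a_k)}b_j$. *)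

theory Defs
  imports "HOL-Algebra.Group"
begin

text \<open>
  The groups \<open>H 1, \<dots>, H r\<close> have their carriers in one common type.  A tuple
  \<open>(h\<^sub>1, \<dots>, h\<^sub>r)\<close> is an extensional function in \<open>\<Pi>\<^sub>E i\<in>{1..r}. carrier (H i)\<close>.
  In a total system, \<open>act S k j h\<^sub>k h\<^sub>j\<close> is the value of \<open>\<phi>\<^sub>k\<^sup>j(h\<^sub>k)\<close> at \<open>h\<^sub>j\<close>, and
  \<open>brk S k j i h\<^sub>k h\<^sub>j\<close> is the \<open>H i\<close>-valued bracket of \<open>h\<^sub>k\<close> and \<open>h\<^sub>j\<close>.
\<close>

record 'a total_system =
  act :: "nat \<Rightarrow> nat \<Rightarrow> 'a \<Rightarrow> 'a \<Rightarrow> 'a"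
  brk :: "nat \<Rightarrow> nat \<Rightarrow> nat \<Rightarrow> 'a \<Rightarrow> 'a \<Rightarrow> 'a"

definition is_total_system ::
  "nat \<Rightarrow> (nat \<Rightarrow> ('a, 'b) monoid_scheme) \<Rightarrow> 'a total_system \<Rightarrow> bool" where
  "is_total_system r H S \<longleftrightarrow>
     (\<forall>k j. 1 \<le> j \<and> j < k \<and> k \<le> r \<longrightarrow>
        act S k j \<in> carrier (H k) \<rightarrow> carrier (H j) \<rightarrow> carrier (H j)) \<and>
     (\<forall>k j i. 1 \<le> i \<and> i < j \<and> j < k \<and> k \<le> r \<longrightarrow>
        brk S k j i \<in> carrier (H k) \<rightarrow> carrier (H j) \<rightarrow> carrier (H i))"

definition normalized_system ::
  "nat \<Rightarrow> (nat \<Rightarrow> ('a, 'b) monoid_scheme) \<Rightarrow> 'a total_system \<Rightarrow> bool" where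
  "normalized_system r H S \<longleftrightarrow>
     (\<forall>j i. 1 \<le> i \<and> i < j \<and> j \<le> r \<longrightarrow>
        (\<forall>h\<in>carrier (H i). act S j i \<one>\<^bsub>H j\<^esub> h = h) \<and>
        (\<forall>h\<in>carrier (H j). act S j i h \<one>\<^bsub>H i\<^esub> = \<one>\<^bsub>H i\<^esub>)) \<and>
     (\<forall>k j i. 1 \<le> i \<and> i < j \<and> j < k \<and> k \<le> r \<longrightarrow>
        (\<forall>h\<in>carrier (H j). brk S k j i \<one>\<^bsub>H k\<^esub> h = \<one>\<^bsub>H i\<^esub>) \<and>
        (\<forall>h\<in>carrier (H k). brk S k j i h \<one>\<^bsub>H j\<^esub> = \<one>\<^bsub>H i\<^esub>))"

definition ones :: "nat \<Rightarrow> (nat \<Rightarrow> ('a, 'b) monoid_scheme) \<Rightarrow> nat \<Rightarrow> 'a" where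
  "ones r H = (\<lambda>i\<in>{1..r}. \<one>\<^bsub>H i\<^esub>)"

definition emb :: "nat \<Rightarrow> (nat \<Rightarrow> ('a, 'b) monoid_scheme) \<Rightarrow> nat \<Rightarrow> 'a \<Rightarrow> nat \<Rightarrow> 'a" where
  "emb r H j h = (\<lambda>i\<in>{1..r}. if i = j then h else \<one>\<^bsub>H i\<^esub>)"

text \<open>\<open>trunc r H k (a\<^sub>1, \<dots>, a\<^sub>r) = (a\<^sub>1, \<dots>, a\<^sub>k, 1, \<dots>, 1)\<close>\<close>

definition trunc ::
  "nat \<Rightarrow> (nat \<Rightarrow> ('a, 'b) monoid_scheme) \<Rightarrow> nat \<Rightarrow> (nat \<Rightarrow> 'a) \<Rightarrow> nat \<Rightarrow> 'a" where
  "trunc r H k a = (\<lambda>i\<in>{1..r}. if i \<le> k then a i else \<one>\<^bsub>H i\<^esub>)"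

text \<open>\<open>phi r H S k j h\<^sub>k h\<^sub>j\<close> is the tuple \<open>\<phi>\<close> with subscript \<open>h\<^sub>k\<close>, evaluated at \<open>h\<^sub>j\<close>, for \<open>k > j\<close>.\<close>

definition phi ::
  "nat \<Rightarrow> (nat \<Rightarrow> ('a, 'b) monoid_scheme) \<Rightarrow> 'a total_system \<Rightarrow>
   nat \<Rightarrow> nat \<Rightarrow> 'a \<Rightarrow> 'a \<Rightarrow> nat \<Rightarrow> 'a" where
  "phi r H S k j hk hj =
     (\<lambda>i\<in>{1..r}. if i < j then brk S k j i hk hj
                 else if i = j then act S k j hk hj
                 else \<one>\<^bsub>H i\<^esub>)"

text \<open>Left-bracketed product \<open>m(w\<^sub>1, \<dots>, w\<^sub>n)\<close> of a nonempty list.\<close>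

definition iter_mult :: "('x \<Rightarrow> 'x \<Rightarrow> 'x) \<Rightarrow> 'x list \<Rightarrow> 'x" where
  "iter_mult m ws = foldl m (hd ws) (tl ws)"

text \<open>
  \<open>mu r H S k\<close> is the multiplication \<open>\<mu>\<^sub>k\<close>; it is meaningful on tuples that are \<open>1\<close> in
  all positions above \<open>k\<close>.  The value at \<open>k = 0\<close> plays no role in the recursion.
\<close>

fun mu ::
  "nat \<Rightarrow> (nat \<Rightarrow> ('a, 'b) monoid_scheme) \<Rightarrow> 'a total_system \<Rightarrow>
   nat \<Rightarrow> (nat \<Rightarrow> 'a) \<Rightarrow> (nat \<Rightarrow> 'a) \<Rightarrow> nat \<Rightarrow> 'a" where
  "mu r H S 0 a b = ones r H"
| "mu r H S (Suc 0) a b = emb r H 1 (a 1 \<otimes>\<^bsub>H 1\<^esub> b 1)"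
| "mu r H S (Suc (Suc k)) a b =
     (let n = Suc k;
          c = mu r H S (Suc k) (trunc r H n a)
                (iter_mult (\<lambda>x y. mu r H S (Suc k) x y)
                  (map (\<lambda>j. phi r H S (Suc n) j (a (Suc n)) (b j)) [1..<Suc n]))
      in (\<lambda>i\<in>{1..r}. if i \<le> n then c i
                     else if i = Suc n then a i \<otimes>\<^bsub>H i\<^esub> b i
                     else \<one>\<^bsub>H i\<^esub>))"

text \<open>
  For a normalized system the tuple of ones is a two-sided identity for \<open>\<mu>\<^sub>r\<close>, so
  it is the only possible choice of unit.
\<close>

definition total_product ::
  "nat \<Rightarrow> (nat \<Rightarrow> ('a, 'b) monoid_scheme) \<Rightarrow> 'a total_system \<Rightarrow> (nat \<Rightarrow> 'a) monoid" where
  "total_product r H S =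
     \<lparr>carrier = (\<Pi>\<^sub>E i\<in>{1..r}. carrier (H i)), mult = mu r H S r, one = ones r H\<rparr>"

definition comm_bracket ::
  "nat \<Rightarrow> (nat \<Rightarrow> ('a, 'b) monoid_scheme) \<Rightarrow> 'a total_system \<Rightarrow>
   nat \<Rightarrow> nat \<Rightarrow> 'a \<Rightarrow> 'a \<Rightarrow> nat \<Rightarrow> 'a" where
  "comm_bracket r H S k j a b =
     phi r H S k j a b \<otimes>\<^bsub>total_product r H S\<^esub> inv\<^bsub>total_product r H S\<^esub> (emb r H j b)"

definition conjugate :: "('a, 'b) monoid_scheme \<Rightarrow> 'a \<Rightarrow> 'a \<Rightarrow> 'a" where
  "conjugate G x y = x \<otimes>\<^bsub>G\<^esub> y \<otimes>\<^bsub>G\<^esub> inv\<^bsub>G\<^esub> x"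

definition commutator :: "('a, 'b) monoid_scheme \<Rightarrow> 'a \<Rightarrow> 'a \<Rightarrow> 'a" where
  "commutator G x y = x \<otimes>\<^bsub>G\<^esub> y \<otimes>\<^bsub>G\<^esub> inv\<^bsub>G\<^esub> x \<otimes>\<^bsub>G\<^esub> inv\<^bsub>G\<^esub> y"

text \<open>\<open>product_map r G' f (h\<^sub>1, \<dots>, h\<^sub>r) = f\<^sub>1(h\<^sub>1) \<cdots> f\<^sub>r(h\<^sub>r)\<close>, the factors in this order.\<close>

definition product_map ::
  "nat \<Rightarrow> ('c, 'd) monoid_scheme \<Rightarrow> (nat \<Rightarrow> 'a \<Rightarrow> 'c) \<Rightarrow> (nat \<Rightarrow> 'a) \<Rightarrow> 'c" where
  "product_map r G' f h = foldr (\<otimes>\<^bsub>G'\<^esub>) (map (\<lambda>i. f i (h i)) [1..<Suc r]) \<one>\<^bsub>G'\<^esub>"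

end

theory Submission imports Defs begin

text \<open>
  Two facts about \<open>G = H\<^sub>1 \<times> \<dots> \<times> H\<^sub>r\<close> carry the proof, and both are read off from the
  recursion for the multiplications \<open>\<mu>\<^sub>k\<close> once the system is normalized.  Appending an entry is
  multiplication: a tuple supported in the positions below \<open>j\<close>, times an element of \<open>H\<^sub>j\<close>, is
  the tuple with that element put at position \<open>j\<close>; hence \<open>(h\<^sub>1, \<dots>, h\<^sub>r) = h\<^sub>1 \<cdots> h\<^sub>r\<close>.
  And \<open>\<phi>\<close> is conjugation: \<open>a\<^sub>k \<cdot> b\<^sub>j = \<phi>\<^bsub>a\<^sub>k\<^esub>(b\<^sub>j) \<cdot> a\<^sub>k\<close> for \<open>k > j\<close>.

  The map \<open>f\<close> respects right multiplication of an element of \<open>R\<^sub>j\<close> by an element of \<open>H\<^sub>j\<close>,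
  because only the last factor of \<open>f\<close> changes and \<open>f\<^sub>j\<close> is a homomorphism.  Since
  \<open>[a\<^sub>k, b\<^sub>j] = \<phi>\<^bsub>a\<^sub>k\<^esub>(b\<^sub>j) \<cdot> b\<^sub>j\<^sup>-\<^sup>1\<close> is such a product, the factor \<open>f(b\<^sub>j)\<^sup>-\<^sup>1\<close> cancels, and the
  commutator condition says exactly that \<open>f(\<phi>\<^bsub>a\<^sub>k\<^esub>(b\<^sub>j))\<close> is the conjugate of \<open>f(b\<^sub>j)\<close> by
  \<open>f(a\<^sub>k)\<close> (lemma \<open>bracket_condition_iff\<close>).  As \<open>\<phi>\<close> is conjugation in \<open>G\<close>, this is the second
  claim, and it is also the forward direction of the first one.

  For the converse, \<open>f\<close> is shown to be multiplicative on \<open>R\<^sub>k\<close> by induction on \<open>k\<close> (lemma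
  \<open>product_map_mu\<close>).  Write \<open>a = a' h\<close> and \<open>b = b' h'\<close> with \<open>a', b' \<in> R\<^sub>k\<close> and
  \<open>h, h' \<in> H\<^bsub>k+1\<^esub>\<close>.  The recursion reads \<open>a \<cdot> b = a' \<cdot> (\<phi>\<^sub>h(b\<^sub>1) \<cdots> \<phi>\<^sub>h(b\<^sub>k)) \<cdot> h h'\<close>, and the
  induction hypothesis with the conjugation condition turns the bracketed product into the
  conjugate of \<open>f(b')\<close> by \<open>f(h)\<close>, so that
  \<open>f(a \<cdot> b) = f(a') f(h) f(b') f(h)\<^sup>-\<^sup>1 f(h) f(h') = f(a) f(b)\<close>.
\<close>

section \<open>Normalized total systems\<close>

locale normalized_total_system =
  fixes r :: nat
    and H :: "nat \<Rightarrow> ('a, 'b) monoid_scheme"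
    and S :: "'a total_system"
  assumes groups: "i \<in> {1..r} \<Longrightarrow> group (H i)"
    and total: "is_total_system r H S"
    and normalized: "normalized_system r H S"
begin

abbreviation unit_tuple where "unit_tuple \<equiv> ones r H"
abbreviation single where "single \<equiv> emb r H"
abbreviation cut where "cut \<equiv> trunc r H"
abbreviation \<phi> where "\<phi> \<equiv> phi r H S"
abbreviation \<mu> where "\<mu> \<equiv> mu r H S"

definition R :: "nat \<Rightarrow> (nat \<Rightarrow> 'a) set" where
  "R k = {a \<in> (\<Pi>\<^sub>E i\<in>{1..r}. carrier (H i)). \<forall>i\<in>{k<..r}. a i = \<one>\<^bsub>H i\<^esub>}"

text \<open>
  The product \<open>\<phi>\<^sub>h(b\<^sub>1) \<cdots> \<phi>\<^sub>h(b\<^sub>m)\<close> for \<open>h \<in> H\<^bsub>n+1\<^esub>\<close>, taken with \<open>\<mu>\<^sub>n\<close>.  It starts from the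
  unit tuple, so that the empty product makes sense and inductions on \<open>m\<close> can begin at \<open>0\<close>.
\<close>

definition phi_prod :: "nat \<Rightarrow> 'a \<Rightarrow> (nat \<Rightarrow> 'a) \<Rightarrow> nat \<Rightarrow> nat \<Rightarrow> 'a" where
  "phi_prod n h b m = foldl (\<mu> n) unit_tuple (map (\<lambda>j. \<phi> (Suc n) j h (b j)) [1..<Suc m])"

lemma phi_prod_0 [simp]: "phi_prod n h b 0 = unit_tuple"
  by (simp add: phi_prod_def)

lemma phi_prod_Suc [simp]:
  "phi_prod n h b (Suc m) = \<mu> n (phi_prod n h b m) (\<phi> (Suc n) (Suc m) h (b (Suc m)))"
  by (simp add: phi_prod_def)

lemma H_one_closed [simp]: "1 \<le> i \<Longrightarrow> i \<le> r \<Longrightarrow> \<one>\<^bsub>H i\<^esub> \<in> carrier (H i)"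
  using groups[of i] by (simp add: group.is_monoid monoid.one_closed)

lemma H_mult_closed [simp]:
  "1 \<le> i \<Longrightarrow> i \<le> r \<Longrightarrow> x \<in> carrier (H i) \<Longrightarrow> y \<in> carrier (H i) \<Longrightarrow> x \<otimes>\<^bsub>H i\<^esub> y \<in> carrier (H i)"
  using groups[of i] by (simp add: group.is_monoid monoid.m_closed)

lemma H_l_one [simp]: "1 \<le> i \<Longrightarrow> i \<le> r \<Longrightarrow> x \<in> carrier (H i) \<Longrightarrow> \<one>\<^bsub>H i\<^esub> \<otimes>\<^bsub>H i\<^esub> x = x"
  using groups[of i] by (simp add: group.is_monoid monoid.l_one)

lemma H_r_one [simp]: "1 \<le> i \<Longrightarrow> i \<le> r \<Longrightarrow> x \<in> carrier (H i) \<Longrightarrow> x \<otimes>\<^bsub>H i\<^esub> \<one>\<^bsub>H i\<^esub> = x"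
  using groups[of i] by (simp add: group.is_monoid monoid.r_one)

lemma act_closed:
  assumes "1 \<le> j" "j < k" "k \<le> r" "h \<in> carrier (H k)" "g \<in> carrier (H j)"
  shows "act S k j h g \<in> carrier (H j)"
proof -
  have "act S k j \<in> carrier (H k) \<rightarrow> carrier (H j) \<rightarrow> carrier (H j)"
    using total assms unfolding is_total_system_def by blast
  then show ?thesis using assms by blast
qed

lemma brk_closed:
  assumes "1 \<le> i" "i < j" "j < k" "k \<le> r" "h \<in> carrier (H k)" "g \<in> carrier (H j)"
  shows "brk S k j i h g \<in> carrier (H i)"
proof -
  have "brk S k j i \<in> carrier (H k) \<rightarrow> carrier (H j) \<rightarrow> carrier (H i)"
    using total assms unfolding is_total_system_def by blast
  then show ?thesis using assms by blast
qed

lemma R_mono: "x \<in> R m \<Longrightarrow> m \<le> n \<Longrightarrow> x \<in> R n"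
  by (auto simp: R_def)

lemma R_entry: "x \<in> R n \<Longrightarrow> 1 \<le> i \<Longrightarrow> i \<le> r \<Longrightarrow> x i \<in> carrier (H i)"
  by (auto simp: R_def)

lemma R_one: "x \<in> R n \<Longrightarrow> n < i \<Longrightarrow> i \<le> r \<Longrightarrow> x i = \<one>\<^bsub>H i\<^esub>"
  by (auto simp: R_def)

lemma R_undefined: "x \<in> R n \<Longrightarrow> i \<notin> {1..r} \<Longrightarrow> x i = undefined"
  by (auto simp: R_def PiE_iff extensional_def)

lemma R_full: "R r = (\<Pi>\<^sub>E i\<in>{1..r}. carrier (H i))"
  by (auto simp: R_def)

lemma R_eqI:
  assumes "x \<in> R m" "y \<in> R n" "\<And>i. 1 \<le> i \<Longrightarrow> i \<le> r \<Longrightarrow> x i = y i"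
  shows "x = y"
proof
  fix i show "x i = y i"
    using assms R_undefined[of x m i] R_undefined[of y n i] by (cases "i \<in> {1..r}") auto
qed

lemma unit_tuple_in_R: "unit_tuple \<in> R n"
  by (auto simp: R_def ones_def)

lemma unit_tuple_entry: "1 \<le> i \<Longrightarrow> i \<le> r \<Longrightarrow> unit_tuple i = \<one>\<^bsub>H i\<^esub>"
  by (simp add: ones_def)

lemma R_0: "x \<in> R 0 \<Longrightarrow> x = unit_tuple"
  by (rule R_eqI[OF _ unit_tuple_in_R[of 0]]) (auto simp: R_one unit_tuple_entry)

lemma single_in_R:
  "1 \<le> j \<Longrightarrow> j \<le> n \<Longrightarrow> j \<le> r \<Longrightarrow> h \<in> carrier (H j) \<Longrightarrow> single j h \<in> R n"
  by (auto simp: R_def emb_def)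

lemma single_entry: "1 \<le> i \<Longrightarrow> i \<le> r \<Longrightarrow> single j h i = (if i = j then h else \<one>\<^bsub>H i\<^esub>)"
  by (simp add: emb_def)

lemma single_one: "single j \<one>\<^bsub>H j\<^esub> = unit_tuple"
  by (auto simp: emb_def ones_def fun_eq_iff)

lemma single_eq_upd: "1 \<le> j \<Longrightarrow> j \<le> r \<Longrightarrow> single j h = unit_tuple(j := h)"
  by (auto simp: emb_def ones_def fun_eq_iff)

lemma cut_in_R: "x \<in> R m \<Longrightarrow> cut n x \<in> R n"
  by (auto simp: R_def trunc_def)

lemma cut_entry: "1 \<le> i \<Longrightarrow> i \<le> r \<Longrightarrow> cut n x i = (if i \<le> n then x i else \<one>\<^bsub>H i\<^esub>)"
  by (simp add: trunc_def)

lemma cut_id: "x \<in> R n \<Longrightarrow> cut n x = x"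
  by (rule R_eqI[OF cut_in_R]) (auto simp: cut_entry R_one)

lemma cut_0: "cut 0 x = unit_tuple"
  by (auto simp: trunc_def ones_def fun_eq_iff)

lemma cut_Suc: "Suc n \<le> r \<Longrightarrow> cut (Suc n) x = (cut n x)(Suc n := x (Suc n))"
  by (auto simp: trunc_def fun_eq_iff)

lemma cut_single:
  "1 \<le> j \<Longrightarrow> j \<le> r \<Longrightarrow> cut n (single j h) = (if j \<le> n then single j h else unit_tuple)"
  by (auto simp: trunc_def emb_def ones_def fun_eq_iff)

lemma upd_in_R:
  "x \<in> R n \<Longrightarrow> Suc n \<le> r \<Longrightarrow> h \<in> carrier (H (Suc n)) \<Longrightarrow> x(Suc n := h) \<in> R (Suc n)"
  by (auto simp: R_def PiE_iff extensional_def)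

lemma upd_one: "x \<in> R n \<Longrightarrow> Suc n \<le> r \<Longrightarrow> x(Suc n := \<one>\<^bsub>H (Suc n)\<^esub>) = x"
  using R_one[of x n "Suc n"] by (simp add: fun_upd_idem)

lemma phi_in_R:
  assumes "1 \<le> j" "j < k" "k \<le> r" "h \<in> carrier (H k)" "g \<in> carrier (H j)" "j \<le> n"
  shows "\<phi> k j h g \<in> R n"
  using assms by (auto simp: R_def phi_def act_closed brk_closed)

lemma phi_one_left:
  assumes "1 \<le> j" "j < k" "k \<le> r" "g \<in> carrier (H j)"
  shows "\<phi> k j \<one>\<^bsub>H k\<^esub> g = single j g"
proof
  fix i show "\<phi> k j \<one>\<^bsub>H k\<^esub> g i = single j g i"
    using normalized assms unfolding normalized_system_def phi_def emb_def by auto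
qed

lemma phi_one_right:
  assumes "1 \<le> j" "j < k" "k \<le> r" "h \<in> carrier (H k)"
  shows "\<phi> k j h \<one>\<^bsub>H j\<^esub> = unit_tuple"
proof
  fix i show "\<phi> k j h \<one>\<^bsub>H j\<^esub> i = unit_tuple i"
    using normalized assms unfolding normalized_system_def phi_def ones_def by auto
qed

section \<open>The multiplications on the partial products\<close>

text \<open>
  The case \<open>n = 0\<close> is the group law of \<open>H\<^sub>1\<close>: there \<open>\<mu>\<^sub>0\<close> and the empty product are the unit
  tuple, so a single recursion describes every \<open>\<mu>\<^bsub>n+1\<^esub>\<close>.  The left unit law lets the product
  of a nonempty list start from the unit tuple, and closure keeps the product in \<open>R\<^sub>n\<close>, so that
  position \<open>n + 1\<close> is the only one to overwrite.
\<close>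

lemma mu_Suc_aux:
  assumes n: "Suc n \<le> r" and a: "a \<in> R (Suc n)" and b: "b \<in> R (Suc n)"
    and closed: "\<And>x y. x \<in> R n \<Longrightarrow> y \<in> R n \<Longrightarrow> \<mu> n x y \<in> R n"
    and l_one: "\<And>x. x \<in> R n \<Longrightarrow> \<mu> n unit_tuple x = x"
  shows "\<mu> (Suc n) a b =
    (\<mu> n (cut n a) (phi_prod n (a (Suc n)) b n))(Suc n := a (Suc n) \<otimes>\<^bsub>H (Suc n)\<^esub> b (Suc n))"
proof (cases n)
  case 0
  then show ?thesis using n by (simp add: single_eq_upd)
next
  case (Suc m)
  let ?h = "a (Suc n)"
  let ?ws = "map (\<lambda>j. \<phi> (Suc n) j ?h (b j)) [1..<Suc n]"
  have h: "?h \<in> carrier (H (Suc n))" using R_entry[OF a] n by simp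
  have phi: "\<phi> (Suc n) j ?h (b j) \<in> R n" if "1 \<le> j" "j \<le> n" for j
    using that n h R_entry[OF b, of j] by (intro phi_in_R) auto
  have "phi_prod n ?h b m' \<in> R n" if "m' \<le> n" for m'
    using that by (induction m') (auto intro!: closed phi simp: unit_tuple_in_R)
  then have prod: "\<mu> n (cut n a) (phi_prod n ?h b n) \<in> R n"
    using cut_in_R[OF a] closed by simp
  have "[1..<Suc n] = 1 # [2..<Suc n]"
    using Suc upt_conv_Cons[of 1 "Suc n"] by (simp add: numeral_2_eq_2)
  then have "iter_mult (\<mu> n) ?ws = phi_prod n ?h b n"
    using l_one[OF phi[of 1]] Suc by (simp add: iter_mult_def phi_prod_def)
  then have "\<mu> (Suc n) a b = (\<lambda>i\<in>{1..r}.
      if i \<le> n then \<mu> n (cut n a) (phi_prod n ?h b n) i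
      else if i = Suc n then a i \<otimes>\<^bsub>H i\<^esub> b i else \<one>\<^bsub>H i\<^esub>)"
    unfolding Suc by (simp add: Let_def del: upt_Suc phi_prod_Suc cong: if_cong)
  then show ?thesis
    using n R_one[OF prod] R_undefined[OF prod] by (auto simp: fun_eq_iff)
qed

text \<open>
  By normalization \<open>\<phi>\<^sub>1(b\<^sub>j) = b\<^sub>j\<close>, so this is \<open>b\<^sub>1 \<cdots> b\<^sub>m = (b\<^sub>1, \<dots>, b\<^sub>m, 1, \<dots>, 1)\<close>, built up one
  entry at a time.  The appending law is a hypothesis here because it is proved for
  \<open>\<mu>\<^bsub>n+1\<^esub>\<close> with the help of this identity for \<open>\<mu>\<^sub>n\<close>.
\<close>

lemma phi_prod_one:
  assumes n: "Suc n \<le> r" and b: "b \<in> R (Suc n)"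
    and append: "\<And>x j h. Suc j \<le> n \<Longrightarrow> x \<in> R j \<Longrightarrow> h \<in> carrier (H (Suc j)) \<Longrightarrow>
      \<mu> n x (single (Suc j) h) = x(Suc j := h)"
    and "m \<le> n"
  shows "phi_prod n \<one>\<^bsub>H (Suc n)\<^esub> b m = cut m b"
  using \<open>m \<le> n\<close>
proof (induction m)
  case (Suc m)
  then show ?case
    using n R_entry[OF b, of "Suc m"]
    by (simp add: phi_one_left append[OF _ cut_in_R[OF b]] cut_Suc)
qed (simp add: cut_0)

text \<open>
  The four statements need one simultaneous induction.  The left unit law for \<open>\<mu>\<^bsub>n+1\<^esub>\<close> uses
  \<open>phi_prod_one\<close> and with it the appending law for \<open>\<mu>\<^sub>n\<close>, the appending law uses the right
  unit law, and the recursion itself uses closure and the left unit law.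
\<close>

lemma mu_basic:
  assumes "n \<le> r"
  shows mu_closed: "\<And>x y. x \<in> R n \<Longrightarrow> y \<in> R n \<Longrightarrow> \<mu> n x y \<in> R n"
    and mu_l_one: "\<And>x. x \<in> R n \<Longrightarrow> \<mu> n unit_tuple x = x"
    and mu_r_one: "\<And>x. x \<in> R n \<Longrightarrow> \<mu> n x unit_tuple = x"
    and mu_append: "\<And>x j h. Suc j \<le> n \<Longrightarrow> x \<in> R j \<Longrightarrow> h \<in> carrier (H (Suc j)) \<Longrightarrow>
      \<mu> n x (single (Suc j) h) = x(Suc j := h)"
proof -
  have "(\<forall>x\<in>R n. \<forall>y\<in>R n. \<mu> n x y \<in> R n) \<and> (\<forall>x\<in>R n. \<mu> n unit_tuple x = x) \<and>
    (\<forall>x\<in>R n. \<mu> n x unit_tuple = x) \<and>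
    (\<forall>j x h. Suc j \<le> n \<and> x \<in> R j \<and> h \<in> carrier (H (Suc j)) \<longrightarrow>
      \<mu> n x (single (Suc j) h) = x(Suc j := h))"
    using assms
  proof (induction n)
    case 0
    then show ?case using R_0 unit_tuple_in_R by auto
  next
    case (Suc n)
    then have n: "Suc n \<le> r"
      and closed: "\<And>x y. x \<in> R n \<Longrightarrow> y \<in> R n \<Longrightarrow> \<mu> n x y \<in> R n"
      and l_one: "\<And>x. x \<in> R n \<Longrightarrow> \<mu> n unit_tuple x = x"
      and r_one: "\<And>x. x \<in> R n \<Longrightarrow> \<mu> n x unit_tuple = x"
      and append: "\<And>x j h. Suc j \<le> n \<Longrightarrow> x \<in> R j \<Longrightarrow> h \<in> carrier (H (Suc j)) \<Longrightarrow>
        \<mu> n x (single (Suc j) h) = x(Suc j := h)"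
      by auto
    note rec = mu_Suc_aux[OF n _ _ closed l_one]
    have prod_closed: "phi_prod n h b m \<in> R n"
      if "m \<le> n" "h \<in> carrier (H (Suc n))" "b \<in> R (Suc n)" for h b m
      using that n
      by (induction m) (auto intro!: closed phi_in_R R_entry simp: unit_tuple_in_R)
    note prod_one_left = phi_prod_one[OF n _ append]
    have prod_one_right: "phi_prod n h unit_tuple m = unit_tuple"
      if "m \<le> n" "h \<in> carrier (H (Suc n))" for h m
      using that n
      by (induction m) (auto simp: unit_tuple_entry phi_one_right l_one unit_tuple_in_R)
    have restrict: "\<mu> (Suc n) x y = \<mu> n x y" if x: "x \<in> R n" and y: "y \<in> R n" for x y
    proof -
      have "\<mu> (Suc n) x y = (\<mu> n x y)(Suc n := \<one>\<^bsub>H (Suc n)\<^esub>)"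
        using rec[OF R_mono[OF x] R_mono[OF y]] n R_one[OF x, of "Suc n"] R_one[OF y, of "Suc n"]
        by (simp add: prod_one_left R_mono[OF y] cut_id x y)
      then show ?thesis using upd_one[OF closed[OF x y] n] by simp
    qed
    have "\<mu> (Suc n) x y \<in> R (Suc n)" if x: "x \<in> R (Suc n)" and y: "y \<in> R (Suc n)" for x y
      using rec[OF x y] R_entry[OF x, of "Suc n"] R_entry[OF y, of "Suc n"] n
      by (simp add: upd_in_R closed cut_in_R[OF x] prod_closed y)
    moreover have "\<mu> (Suc n) unit_tuple x = x" if x: "x \<in> R (Suc n)" for x
      using rec[OF unit_tuple_in_R x] R_entry[OF x, of "Suc n"] n cut_Suc[OF n, of x]
      by (simp add: unit_tuple_entry prod_one_left x cut_id unit_tuple_in_R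
          l_one cut_in_R[OF x])
    moreover have "\<mu> (Suc n) x unit_tuple = x" if x: "x \<in> R (Suc n)" for x
      using rec[OF x unit_tuple_in_R] R_entry[OF x, of "Suc n"] n cut_Suc[OF n, of x]
      by (simp add: unit_tuple_entry prod_one_right cut_id x r_one cut_in_R[OF x])
    moreover have "\<mu> (Suc n) x (single (Suc j) h) = x(Suc j := h)"
      if j: "Suc j \<le> Suc n" and x: "x \<in> R j" and h: "h \<in> carrier (H (Suc j))" for x j h
    proof (cases "j = n")
      case True
      have s: "single (Suc n) h \<in> R (Suc n)" using True h n by (simp add: single_in_R)
      show ?thesis
        using rec[OF R_mono[OF x] s] n x h True R_one[OF x, of "Suc n"]
        by (simp add: single_entry prod_one_left s cut_single cut_id r_one)
    next
      case False
      then have "x \<in> R n" "single (Suc j) h \<in> R n"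
        using R_mono[OF x] j h n by (auto simp: single_in_R)
      then show ?thesis using restrict append[OF _ x h] False j by simp
    qed
    ultimately show ?case by blast
  qed
  then show "\<And>x y. x \<in> R n \<Longrightarrow> y \<in> R n \<Longrightarrow> \<mu> n x y \<in> R n"
    and "\<And>x. x \<in> R n \<Longrightarrow> \<mu> n unit_tuple x = x"
    and "\<And>x. x \<in> R n \<Longrightarrow> \<mu> n x unit_tuple = x"
    and "\<And>x j h. Suc j \<le> n \<Longrightarrow> x \<in> R j \<Longrightarrow> h \<in> carrier (H (Suc j)) \<Longrightarrow>
      \<mu> n x (single (Suc j) h) = x(Suc j := h)"
    by blast+
qed

lemma mu_Suc:
  assumes "Suc n \<le> r" "a \<in> R (Suc n)" "b \<in> R (Suc n)"
  shows "\<mu> (Suc n) a b =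
    (\<mu> n (cut n a) (phi_prod n (a (Suc n)) b n))(Suc n := a (Suc n) \<otimes>\<^bsub>H (Suc n)\<^esub> b (Suc n))"
  using assms by (intro mu_Suc_aux mu_closed mu_l_one) auto

lemma phi_prod_closed:
  assumes "Suc n \<le> r" "m \<le> n" "h \<in> carrier (H (Suc n))" "b \<in> R (Suc n)"
  shows "phi_prod n h b m \<in> R n"
  using assms(2)
proof (induction m)
  case (Suc m)
  then show ?case
    using assms R_entry[of b "Suc n" "Suc m"]
    by (auto intro!: mu_closed phi_in_R)
qed (simp add: unit_tuple_in_R)

text \<open>
  With only one entry different from \<open>1\<close>, all but one of the factors \<open>\<phi>\<^sub>h(b\<^sub>i)\<close> are trivial.
\<close>

lemma phi_prod_single:
  assumes n: "Suc n \<le> r" and m: "m \<le> n" and h: "h \<in> carrier (H (Suc n))"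
    and j: "1 \<le> j" "j \<le> r" and g: "g \<in> carrier (H j)"
  shows "phi_prod n h (single j g) m = (if j \<le> m then \<phi> (Suc n) j h g else unit_tuple)"
  using m
proof (induction m)
  case (Suc m)
  consider "Suc m < j" | "Suc m = j" | "j < Suc m" by linarith
  then show ?case
  proof cases
    case 1
    then show ?thesis
      using Suc n h by (simp add: single_entry phi_one_right mu_l_one unit_tuple_in_R)
  next
    case 2
    have "\<phi> (Suc n) j h g \<in> R n" using Suc.prems 2 n h j g by (intro phi_in_R) auto
    with 2 Suc n show ?thesis by (auto simp add: single_entry mu_l_one)
  next
    case 3
    have "\<phi> (Suc n) j h g \<in> R n" using Suc.prems 3 n h j g by (intro phi_in_R) auto
    with 3 Suc n h show ?thesis by (simp add: single_entry phi_one_right mu_r_one)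
  qed
qed (use j in simp)

lemma mu_restrict:
  assumes "n \<le> k" "k \<le> r" and x: "x \<in> R n" and y: "y \<in> R n"
  shows "\<mu> k x y = \<mu> n x y"
  using assms(1,2)
proof (induction k rule: dec_induct)
  case (step k)
  have k: "Suc k \<le> r" using step by simp
  have xk: "x \<in> R k" and yk: "y \<in> R k" using x y step R_mono by auto
  have units: "x (Suc k) = \<one>\<^bsub>H (Suc k)\<^esub>" "y (Suc k) = \<one>\<^bsub>H (Suc k)\<^esub>"
    using R_one[OF xk] R_one[OF yk] k by auto
  have "phi_prod k \<one>\<^bsub>H (Suc k)\<^esub> y k = cut k y"
    using k mu_append[of k] by (intro phi_prod_one R_mono[OF yk]) auto
  then have "\<mu> (Suc k) x y = (\<mu> k x y)(Suc k := \<one>\<^bsub>H (Suc k)\<^esub>)"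
    using mu_Suc[OF k R_mono[OF xk] R_mono[OF yk]] k
    by (simp add: units cut_id[OF xk] cut_id[OF yk])
  also have "\<dots> = \<mu> k x y" using upd_one[OF mu_closed[OF _ xk yk]] k by simp
  finally show ?case using step by simp
qed simp

lemma mu_single_single:
  assumes j: "1 \<le> j" "j \<le> r" and g: "g \<in> carrier (H j)" "h \<in> carrier (H j)"
  shows "\<mu> r (single j g) (single j h) = single j (g \<otimes>\<^bsub>H j\<^esub> h)"
proof -
  obtain n where n: "j = Suc n" using j by (cases j) auto
  have s: "single j g \<in> R j" "single j h \<in> R j" using assms single_in_R by auto
  have "\<mu> r (single j g) (single j h) = \<mu> j (single j g) (single j h)"
    using mu_restrict s j by simp
  also have "\<dots> = unit_tuple(j := g \<otimes>\<^bsub>H j\<^esub> h)"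
    using mu_Suc[of n "single j g" "single j h"] s j g unfolding n
    by (simp add: single_entry cut_single phi_prod_single mu_l_one unit_tuple_in_R)
  finally show ?thesis using j by (simp add: single_eq_upd)
qed

text \<open>
  This is \<open>a \<cdot> b = \<phi>\<^sub>a(b) \<cdot> a\<close>: both sides are the tuple \<open>\<phi>\<^sub>a(b)\<close> with \<open>a\<close> put at position \<open>k\<close>,
  the left side by the recursion and the right side by the appending law.
\<close>

lemma mu_swap:
  assumes j: "1 \<le> j" "j < k" and k: "k \<le> r"
    and a: "a \<in> carrier (H k)" and b: "b \<in> carrier (H j)"
  shows "\<mu> r (single k a) (single j b) = \<mu> r (\<phi> k j a b) (single k a)"
proof -
  obtain n where n: "k = Suc n" using j by (cases k) auto
  have s: "single k a \<in> R k" "single j b \<in> R k" using assms single_in_R by auto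
  have p: "\<phi> k j a b \<in> R n" using assms n by (intro phi_in_R) auto
  have "\<mu> r (single k a) (single j b) = \<mu> k (single k a) (single j b)"
    using mu_restrict s k by simp
  also have "\<dots> = (\<phi> k j a b)(k := a)"
    using mu_Suc[of n "single k a" "single j b"] s j k a b p unfolding n
    by (simp add: single_entry cut_single phi_prod_single mu_l_one)
  also have "\<dots> = \<mu> r (\<phi> k j a b) (single k a)"
    using mu_append[of r n "\<phi> k j a b" a] p k a unfolding n by simp
  finally show ?thesis .
qed

end

section \<open>The product of homomorphisms\<close>

locale total_system_homs = normalized_total_system r H S + T: group G'
  for r :: nat
    and H :: "nat \<Rightarrow> ('a, 'b) monoid_scheme"
    and S :: "'a total_system"
    and G' :: "('c, 'd) monoid_scheme" (structure) +
  fixes f :: "nat \<Rightarrow> 'a \<Rightarrow> 'c"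
  assumes homs: "i \<in> {1..r} \<Longrightarrow> f i \<in> hom (H i) G'"
begin

abbreviation F where "F \<equiv> product_map r G' f"

lemma f_closed [simp]: "1 \<le> i \<Longrightarrow> i \<le> r \<Longrightarrow> x \<in> carrier (H i) \<Longrightarrow> f i x \<in> carrier G'"
  using homs[of i] by (auto simp: hom_def)

lemma f_mult:
  "1 \<le> i \<Longrightarrow> i \<le> r \<Longrightarrow> x \<in> carrier (H i) \<Longrightarrow> y \<in> carrier (H i) \<Longrightarrow>
    f i (x \<otimes>\<^bsub>H i\<^esub> y) = f i x \<otimes> f i y"
  using homs[of i] by (auto simp: hom_def)

lemma f_one: "1 \<le> i \<Longrightarrow> i \<le> r \<Longrightarrow> f i \<one>\<^bsub>H i\<^esub> = \<one>"
  using group_hom.hom_one[of "H i" G' "f i"] groups[of i] homs[of i] T.is_group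
  by (simp add: group_hom_def group_hom_axioms_def)

lemma f_inv: "1 \<le> i \<Longrightarrow> i \<le> r \<Longrightarrow> x \<in> carrier (H i) \<Longrightarrow> f i (inv\<^bsub>H i\<^esub> x) = inv (f i x)"
  using group_hom.hom_inv[of "H i" G' "f i"] groups[of i] homs[of i] T.is_group
  by (simp add: group_hom_def group_hom_axioms_def)

lemma foldr_mult_shift:
  assumes "set ws \<subseteq> carrier G'" "z \<in> carrier G'"
  shows "foldr (\<otimes>) ws \<one> \<in> carrier G' \<and> foldr (\<otimes>) ws z = foldr (\<otimes>) ws \<one> \<otimes> z"
  using assms by (induction ws) (auto simp: T.m_assoc)

lemma product_map_closed:
  assumes "x \<in> R m" "n \<le> r"
  shows "product_map n G' f x \<in> carrier G'"
proof -
  have "set (map (\<lambda>i. f i (x i)) [1..<Suc n]) \<subseteq> carrier G'"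
    using assms R_entry[OF assms(1)] by (auto simp del: upt_Suc)
  then show ?thesis unfolding product_map_def using foldr_mult_shift by blast
qed

lemma product_map_0 [simp]: "product_map 0 G' f x = \<one>"
  by (simp add: product_map_def)

lemma product_map_Suc:
  assumes "x \<in> R m" "Suc n \<le> r"
  shows "product_map (Suc n) G' f x = product_map n G' f x \<otimes> f (Suc n) (x (Suc n))"
proof -
  have "set (map (\<lambda>i. f i (x i)) [1..<Suc n]) \<subseteq> carrier G'"
    using assms R_entry[OF assms(1)] by (auto simp del: upt_Suc)
  moreover have "f (Suc n) (x (Suc n)) \<in> carrier G'"
    using assms R_entry[OF assms(1)] by simp
  moreover have "[1..<Suc (Suc n)] = [1..<Suc n] @ [Suc n]" by simp
  ultimately show ?thesis
    using foldr_mult_shift[of "map (\<lambda>i. f i (x i)) [1..<Suc n]" "f (Suc n) (x (Suc n))"]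
    unfolding product_map_def by (simp del: upt_Suc)
qed

lemma product_map_cong:
  assumes "\<And>i. 1 \<le> i \<Longrightarrow> i \<le> n \<Longrightarrow> x i = y i"
  shows "product_map n G' f x = product_map n G' f y"
proof -
  have "map (\<lambda>i. f i (x i)) [1..<Suc n] = map (\<lambda>i. f i (y i)) [1..<Suc n]"
    using assms by (auto simp del: upt_Suc)
  then show ?thesis unfolding product_map_def by (rule arg_cong)
qed

lemma product_map_prefix:
  assumes x: "x \<in> R n" and "n \<le> r"
  shows "F x = product_map n G' f x"
proof -
  have "product_map m G' f x = product_map n G' f x" if "n \<le> m" "m \<le> r" for m
    using that
  proof (induction m rule: dec_induct)
    case (step m)
    then show ?case
      using product_map_Suc[OF x, of m] R_one[OF x, of "Suc m"]
      by (simp add: f_one product_map_closed[OF x])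
  qed simp
  from this[of r] show ?thesis using assms by simp
qed

lemma F_upd:
  assumes x: "x \<in> R n" and n: "Suc n \<le> r" and h: "h \<in> carrier (H (Suc n))"
  shows "F (x(Suc n := h)) = F x \<otimes> f (Suc n) h"
proof -
  have "F (x(Suc n := h)) = product_map n G' f (x(Suc n := h)) \<otimes> f (Suc n) h"
    using product_map_prefix[OF upd_in_R[OF x n h] n] product_map_Suc[OF upd_in_R[OF x n h] n]
    by simp
  also have "product_map n G' f (x(Suc n := h)) = product_map n G' f x"
    by (rule product_map_cong) simp
  finally show ?thesis using product_map_prefix[OF x] n by (simp del: fun_upd_apply)
qed

lemma F_closed: "x \<in> R n \<Longrightarrow> F x \<in> carrier G'"
  by (simp add: product_map_closed)

lemma F_unit: "F unit_tuple = \<one>"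
  using product_map_prefix[OF unit_tuple_in_R, of 0] by simp

lemma F_single:
  assumes "1 \<le> j" "j \<le> r" "h \<in> carrier (H j)"
  shows "F (single j h) = f j h"
proof -
  obtain n where "j = Suc n" using assms by (cases j) auto
  then show ?thesis
    using F_upd[OF unit_tuple_in_R, of n h] assms by (simp add: single_eq_upd F_unit)
qed

text \<open>
  For \<open>h \<in> H\<^bsub>n+1\<^esub>\<close> the elements \<open>\<phi>\<^sub>h(b\<^sub>1), \<dots>, \<phi>\<^sub>h(b\<^sub>n)\<close> lie in \<open>R\<^sub>n\<close>, where \<open>F\<close> is multiplicative
  by the induction hypothesis.  Their product is therefore sent to a product of conjugates by
  \<open>f(h)\<close>, which is the conjugate of \<open>f\<^sub>1(b\<^sub>1) \<cdots> f\<^sub>n(b\<^sub>n)\<close>.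
\<close>

lemma product_map_mu:
  assumes conj: "\<And>k j a b. 1 \<le> j \<Longrightarrow> j < k \<Longrightarrow> k \<le> r \<Longrightarrow> a \<in> carrier (H k) \<Longrightarrow>
      b \<in> carrier (H j) \<Longrightarrow> F (\<phi> k j a b) = conjugate G' (f k a) (f j b)"
    and "n \<le> r" "a \<in> R n" "b \<in> R n"
  shows "F (\<mu> n a b) = F a \<otimes> F b"
  using assms(2-)
proof (induction n arbitrary: a b)
  case 0
  then show ?case using R_0[of a] R_0[of b] by (simp add: F_unit)
next
  case (Suc n)
  note mult = Suc.IH and n = Suc.prems(1) and a = Suc.prems(2) and b = Suc.prems(3)
  let ?h = "a (Suc n)" and ?h' = "b (Suc n)"
  let ?g = "f (Suc n) ?h"
  have h: "?h \<in> carrier (H (Suc n))" "?h' \<in> carrier (H (Suc n))"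
    using R_entry[OF a] R_entry[OF b] n by auto
  then have g: "?g \<in> carrier G'" "f (Suc n) ?h' \<in> carrier G'" using n by auto
  have cancel: "inv ?g \<otimes> (?g \<otimes> z) = z" if "z \<in> carrier G'" for z
    using that g by (simp flip: T.m_assoc)
  have split: "F x = F (cut n x) \<otimes> f (Suc n) (x (Suc n))" if x: "x \<in> R (Suc n)" for x
    using F_upd[OF cut_in_R[OF x] n R_entry[OF x]] n cut_Suc[OF n, of x] cut_id[OF x] by simp
  have prod: "F (phi_prod n ?h b m) = ?g \<otimes> product_map m G' f b \<otimes> inv ?g" if "m \<le> n" for m
    using that
  proof (induction m)
    case 0
    then show ?case using g by (simp add: F_unit)
  next
    case (Suc m)
    have bm: "b (Suc m) \<in> carrier (H (Suc m))" using R_entry[OF b] Suc.prems n by simp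
    have fm: "f (Suc m) (b (Suc m)) \<in> carrier G'" using bm Suc.prems n by simp
    have pm: "product_map m G' f b \<in> carrier G'"
      using product_map_closed[OF b] Suc.prems n by simp
    have "F (phi_prod n ?h b (Suc m)) =
        F (phi_prod n ?h b m) \<otimes> F (\<phi> (Suc n) (Suc m) ?h (b (Suc m)))"
      using Suc.prems n h bm
      by (simp add: mult
          phi_prod_closed[OF n _ h(1) b] phi_in_R)
    also have "\<dots> = (?g \<otimes> product_map m G' f b \<otimes> inv ?g) \<otimes>
        (?g \<otimes> f (Suc m) (b (Suc m)) \<otimes> inv ?g)"
      using Suc n h bm by (simp add: conj conjugate_def)
    also have "\<dots> = ?g \<otimes> (product_map m G' f b \<otimes> f (Suc m) (b (Suc m))) \<otimes> inv ?g"
      using g fm pm by (simp add: T.m_assoc cancel)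
    finally show ?case using product_map_Suc[OF b] Suc.prems n by simp
  qed
  have cutb: "product_map n G' f b = F (cut n b)"
    unfolding product_map_prefix[OF cut_in_R[OF b] Suc_leD[OF n]]
    using n by (intro product_map_cong) (simp add: cut_entry)
  have P: "phi_prod n ?h b n \<in> R n" using phi_prod_closed[OF n _ h(1) b] by simp
  have "F (\<mu> (Suc n) a b) = F (\<mu> n (cut n a) (phi_prod n ?h b n)) \<otimes> f (Suc n) (?h \<otimes>\<^bsub>H (Suc n)\<^esub> ?h')"
    using mu_Suc[OF n a b] F_upd[OF mu_closed[OF _ cut_in_R[OF a] P] n] n h by simp
  also have "\<dots> = (F (cut n a) \<otimes> (?g \<otimes> F (cut n b) \<otimes> inv ?g)) \<otimes> (?g \<otimes> f (Suc n) ?h')"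
    using mult[OF _ cut_in_R[OF a] P] prod[of n] n h by (simp add: cutb f_mult)
  also have "\<dots> = (F (cut n a) \<otimes> ?g) \<otimes> (F (cut n b) \<otimes> f (Suc n) ?h')"
    using g F_closed[OF cut_in_R[OF a, of n]] F_closed[OF cut_in_R[OF b, of n]]
    by (simp add: T.m_assoc cancel)
  finally show ?case using split[OF a] split[OF b] by simp
qed

end

section \<open>Brackets and conjugates in the total product\<close>

locale total_product_homs = total_system_homs r H S G' f + G: group "total_product r H S"
  for r :: nat
    and H :: "nat \<Rightarrow> ('a, 'b) monoid_scheme"
    and S :: "'a total_system"
    and G' :: "('c, 'd) monoid_scheme" (structure)
    and f :: "nat \<Rightarrow> 'a \<Rightarrow> 'c"
begin

abbreviation G where "G \<equiv> total_product r H S"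

lemma G_simps: "carrier G = R r" "x \<otimes>\<^bsub>G\<^esub> y = \<mu> r x y" "\<one>\<^bsub>G\<^esub> = unit_tuple"
  by (simp_all add: total_product_def R_full)

lemma inv_single:
  assumes "1 \<le> j" "j \<le> r" "h \<in> carrier (H j)"
  shows "inv\<^bsub>G\<^esub> (single j h) = single j (inv\<^bsub>H j\<^esub> h)"
proof (rule G.inv_equality)
  interpret Hj: group "H j" using groups assms by simp
  show "single j (inv\<^bsub>H j\<^esub> h) \<otimes>\<^bsub>G\<^esub> single j h = \<one>\<^bsub>G\<^esub>"
    using assms by (simp add: G_simps mu_single_single single_one)
  show "single j h \<in> carrier G" "single j (inv\<^bsub>H j\<^esub> h) \<in> carrier G"
    using assms by (simp_all add: G_simps single_in_R)
qed

lemma conjugate_eq_phi: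
  assumes "1 \<le> j" "j < k" "k \<le> r" "a \<in> carrier (H k)" "b \<in> carrier (H j)"
  shows "conjugate G (single k a) (single j b) = \<phi> k j a b"
proof -
  have c: "single k a \<in> carrier G" "\<phi> k j a b \<in> carrier G"
    using assms by (auto simp: G_simps intro!: single_in_R phi_in_R)
  have "single k a \<otimes>\<^bsub>G\<^esub> single j b = \<phi> k j a b \<otimes>\<^bsub>G\<^esub> single k a"
    using mu_swap[OF assms] by (simp add: G_simps)
  then show ?thesis using c by (simp add: conjugate_def G.m_assoc)
qed

lemma F_mult_single:
  assumes x: "x \<in> R j" and j: "1 \<le> j" "j \<le> r" and h: "h \<in> carrier (H j)"
  shows "F (x \<otimes>\<^bsub>G\<^esub> single j h) = F x \<otimes> f j h"
proof -
  obtain n where n: "j = Suc n" using j by (cases j) auto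
  let ?y = "cut n x"
  have y: "?y \<in> R n" using cut_in_R[OF x] .
  have xj: "x j \<in> carrier (H j)" using R_entry[OF x] j by simp
  have x_eq: "x = ?y(j := x j)" using cut_id[OF x] cut_Suc[of n x] j n by simp
  have append: "?y \<otimes>\<^bsub>G\<^esub> single j g = ?y(j := g)" if "g \<in> carrier (H j)" for g
    using mu_append[of r n ?y g] y j that n by (simp add: G_simps)
  have F_append: "F (?y(j := g)) = F ?y \<otimes> f j g" if "g \<in> carrier (H j)" for g
    using F_upd[OF y] that j n by simp
  have "x \<otimes>\<^bsub>G\<^esub> single j h = (?y \<otimes>\<^bsub>G\<^esub> single j (x j)) \<otimes>\<^bsub>G\<^esub> single j h"
    using append[OF xj] x_eq by simp
  also have "\<dots> = ?y \<otimes>\<^bsub>G\<^esub> (single j (x j) \<otimes>\<^bsub>G\<^esub> single j h)"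
    using y j h xj n by (intro G.m_assoc) (auto simp: G_simps single_in_R intro: R_mono)
  also have "\<dots> = ?y(j := x j \<otimes>\<^bsub>H j\<^esub> h)"
    using append[of "x j \<otimes>\<^bsub>H j\<^esub> h"] j h xj by (simp add: G_simps mu_single_single)
  finally have "F (x \<otimes>\<^bsub>G\<^esub> single j h) = F ?y \<otimes> f j (x j) \<otimes> f j h"
    using F_append[of "x j \<otimes>\<^bsub>H j\<^esub> h"] j h xj F_closed[OF y]
    by (simp add: f_mult T.m_assoc)
  also have "F ?y \<otimes> f j (x j) = F x"
    using F_append[OF xj] x_eq by simp
  finally show ?thesis .
qed

text \<open>
  Both sides of the commutator condition end in the factor \<open>f(b)\<^sup>-\<^sup>1\<close>.
\<close>

lemma bracket_condition_iff:
  assumes "1 \<le> j" "j < k" "k \<le> r" "a \<in> carrier (H k)" "b \<in> carrier (H j)"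
  shows "F (comm_bracket r H S k j a b) = commutator G' (F (single k a)) (F (single j b)) \<longleftrightarrow>
    F (\<phi> k j a b) = conjugate G' (f k a) (f j b)"
proof -
  interpret Hj: group "H j" using groups assms by simp
  have p: "\<phi> k j a b \<in> R j" using assms by (intro phi_in_R) auto
  have fs: "f k a \<in> carrier G'" "f j b \<in> carrier G'" using assms by auto
  have "F (comm_bracket r H S k j a b) = F (\<phi> k j a b) \<otimes> inv (f j b)"
    using assms F_mult_single[OF p] by (simp add: comm_bracket_def inv_single f_inv)
  moreover have "commutator G' (F (single k a)) (F (single j b)) =
      conjugate G' (f k a) (f j b) \<otimes> inv (f j b)"
    using assms by (simp add: F_single commutator_def conjugate_def)
  moreover have "conjugate G' (f k a) (f j b) \<in> carrier G'"
    using fs by (simp add: conjugate_def)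
  ultimately show ?thesis using fs F_closed[OF p] by simp
qed

lemma F_hom_iff:
  "F \<in> hom G G' \<longleftrightarrow>
    (\<forall>k j. 1 \<le> j \<and> j < k \<and> k \<le> r \<longrightarrow> (\<forall>a\<in>carrier (H k). \<forall>b\<in>carrier (H j).
      F (\<phi> k j a b) = conjugate G' (f k a) (f j b)))"
proof
  assume hom: "F \<in> hom G G'"
  then interpret hom: group_hom G G' F by unfold_locales
  show "\<forall>k j. 1 \<le> j \<and> j < k \<and> k \<le> r \<longrightarrow> (\<forall>a\<in>carrier (H k). \<forall>b\<in>carrier (H j).
      F (\<phi> k j a b) = conjugate G' (f k a) (f j b))"
  proof (intro allI impI ballI)
    fix k j a b
    assume *: "1 \<le> j \<and> j < k \<and> k \<le> r" "a \<in> carrier (H k)" "b \<in> carrier (H j)"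
    then have "single k a \<in> carrier G" "single j b \<in> carrier G"
      by (simp_all add: G_simps single_in_R)
    then have "F (conjugate G (single k a) (single j b)) =
        conjugate G' (F (single k a)) (F (single j b))"
      by (simp add: conjugate_def)
    then show "F (\<phi> k j a b) = conjugate G' (f k a) (f j b)"
      using * by (simp add: conjugate_eq_phi F_single)
  qed
next
  assume "\<forall>k j. 1 \<le> j \<and> j < k \<and> k \<le> r \<longrightarrow> (\<forall>a\<in>carrier (H k). \<forall>b\<in>carrier (H j).
      F (\<phi> k j a b) = conjugate G' (f k a) (f j b))"
  then show "F \<in> hom G G'"
    by (auto simp: hom_def G_simps F_closed intro!: product_map_mu)
qed

end

section \<open>Homomorphisms out of the total product\<close>

theorem corollary7p5:
  fixes r :: nat
    and H :: "nat \<Rightarrow> ('a, 'b) monoid_scheme"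
    and S :: "'a total_system"
    and G' :: "('c, 'd) monoid_scheme"
    and f :: "nat \<Rightarrow> 'a \<Rightarrow> 'c"
  assumes "r \<ge> 1"
    and "\<And>i. i \<in> {1..r} \<Longrightarrow> group (H i)"
    and "is_total_system r H S"
    and "normalized_system r H S"
    and "group (total_product r H S)"
    and "group G'"
    and "\<And>i. i \<in> {1..r} \<Longrightarrow> f i \<in> hom (H i) G'"
  shows "(product_map r G' f \<in> hom (total_product r H S) G' \<longleftrightarrow>
      (\<forall>k j. 1 \<le> j \<and> j < k \<and> k \<le> r \<longrightarrow>
        (\<forall>a\<in>carrier (H k). \<forall>b\<in>carrier (H j).
          product_map r G' f (comm_bracket r H S k j a b) =
          commutator G' (product_map r G' f (emb r H k a)) (product_map r G' f (emb r H j b))))) \<and>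
    (\<forall>k j. 1 \<le> j \<and> j < k \<and> k \<le> r \<longrightarrow>
      (\<forall>a\<in>carrier (H k). \<forall>b\<in>carrier (H j).
        conjugate (total_product r H S) (emb r H k a) (emb r H j b) \<in> emb r H j ` carrier (H j)) \<longrightarrow>
      ((\<forall>a\<in>carrier (H k). \<forall>b\<in>carrier (H j).
          product_map r G' f (comm_bracket r H S k j a b) =
          commutator G' (product_map r G' f (emb r H k a)) (product_map r G' f (emb r H j b))) \<longleftrightarrow>
       (\<forall>a\<in>carrier (H k). \<forall>b\<in>carrier (H j).
          product_map r G' f (conjugate (total_product r H S) (emb r H k a) (emb r H j b)) =
          conjugate G' (product_map r G' f (emb r H k a)) (product_map r G' f (emb r H j b)))))"
proof -
  interpret total_product_homs r H S G' f
    using assms by (auto simp: total_product_homs_def total_system_homs_def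
        normalized_total_system_def total_system_homs_axioms_def)
  have bracket: "(\<forall>a\<in>carrier (H k). \<forall>b\<in>carrier (H j).
        F (comm_bracket r H S k j a b) = commutator G' (F (single k a)) (F (single j b))) \<longleftrightarrow>
      (\<forall>a\<in>carrier (H k). \<forall>b\<in>carrier (H j). F (\<phi> k j a b) = conjugate G' (f k a) (f j b))"
    if "1 \<le> j" "j < k" "k \<le> r" for k j
    using bracket_condition_iff[OF that] by blast
  have conj: "(\<forall>a\<in>carrier (H k). \<forall>b\<in>carrier (H j).
        F (conjugate G (single k a) (single j b)) =
        conjugate G' (F (single k a)) (F (single j b))) \<longleftrightarrow>
      (\<forall>a\<in>carrier (H k). \<forall>b\<in>carrier (H j). F (\<phi> k j a b) = conjugate G' (f k a) (f j b))"
    if "1 \<le> j" "j < k" "k \<le> r" for k j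
    using that by (simp add: conjugate_eq_phi F_single)
  show ?thesis
    unfolding F_hom_iff by (simp add: bracket conj cong: imp_cong)
qed

end
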